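(* Let $\mathbf{T}\equiv(T_1,T_2)$ be a commuting, (jointly) hyponormal $2$-variable weighted shift with weight sequences $\{\alpha_{\mathbf{k}}\}$ and $\{\beta_{\mathbf{k}}\}$, $\mathbf{k}\in\mathbb{Z}_+^2$. (i) If $T_1$ is quadratically hyponormal and $\alpha_{(k_1,k_2)+\boldsymbol{\varepsilon}_1}=\alpha_{(k_1,k_2)}$ for some $k_1,k_2\geq 1$, then $(T_1,T_2(I\otimes U_+^{k_2-1}))$ is horizontally flat, that is, $\alpha_{(i,\ell)}=\alpha_{(1,k_2)}$ for all $i\geq 1$ and all $\ell\geq k_2$. (ii) If, instead, $T_2$ is quadratically hyponormal and $\beta_{(k_1,k_2)+\boldsymbol{\varepsilon}_2}=\beta_{(k_1,k_2)}$ for some $k_1,k_2\geq 1$, then $(T_1(U_+^{k_1-1}\otimes I),T_2)$ is vertically flat, that is, $\beta_{(\ell,j)}=\beta_{(k_1,1)}$ for all $\ell\geq k_1$ and all $j\geq 1$.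
   Context: Let $\{\alpha_{\mathbf{k}}\},\{\beta_{\mathbf{k}}\}\in\ell^\infty(\mathbb{Z}_+^2)$ be bounded families of positive numbers, let $\{e_{\mathbf{k}}\}$ be the canonical orthonormal basis of $\ell^2(\mathbb{Z}_+^2)\cong\ell^2(\mathbb{Z}_+)\otimes\ell^2(\mathbb{Z}_+)$, $\boldsymbol{\varepsilon}_1=(1,0)$, $\boldsymbol{\varepsilon}_2=(0,1)$. The $2$-variable weighted shift $\mathbf{T}\equiv(T_1,T_2)$ is defined by $T_1e_{\mathbf{k}}=\alpha_{\mathbf{k}}e_{\mathbf{k}+\boldsymbol{\varepsilon}_1}$, $T_2e_{\mathbf{k}}=\beta_{\mathbf{k}}e_{\mathbf{k}+\boldsymbol{\varepsilon}_2}$. It is commuting ($T_1T_2=T_2T_1$) iff $\beta_{\mathbf{k}+\boldsymbol{\varepsilon}_1}\alpha_{\mathbf{k}}=\alpha_{\mathbf{k}+\boldsymbol{\varepsilon}_2}\beta_{\mathbf{k}}$ for all $\mathbf{k}$. With $[S,T]:=ST-TS$, a commuting pair is (jointly) hyponormal if the operator matrix $\begin{pmatrix}[T_1^*,T_1]&[T_2^*,T_1]\\ [T_1^*,T_2]&[T_2^*,T_2]\end{pmatrix}$ is positive on the direct sum of two copies of the space. A bounded operator $S$ is hyponormal if $S^*S\geq SS^*$, and quadratically hyponormal if $p(S)$ is hyponormal for every complex polynomial $p$ of degree at most $2$. $U_+$ denotes the (unweighted) unilateral shift on $\ell^2(\mathbb{Z}_+)$. A $2$-variable weighted shift is horizontally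 flat if $\alpha_{(k_1,k_2)}=\alpha_{(1,1)}$ for all $k_1,k_2\geq1$, and vertically flat if $\beta_{(k_1,k_2)}=\beta_{(1,1)}$ for all $k_1,k_2\geq1$. For the pairs $(T_1,T_2(I\otimes U_+^{k_2-1}))$ and $(T_1(U_+^{k_1-1}\otimes I),T_2)$ flatness is understood as the weight equalities spelled out in the claim, i.e. flatness of $\mathbf{T}$ over indices in rows at level $k_2$ or above (respectively, columns $k_1$ and beyond). *)

theory Defs
  imports "HOL-Analysis.Analysis" "HOL-Computational_Algebra.Polynomial"
begin

section \<open>The complex Hilbert space of square-summable families\<close>

typedef 'i ell2 = "{x :: 'i \<Rightarrow> complex. (\<lambda>i. (cmod (x i))\<^sup>2) summable_on UNIV}"
  morphisms coord Abs_ell2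
  by (rule exI[of _ "\<lambda>_. 0"]) simp

setup_lifting type_definition_ell2

lemma coord_square_summable: "(\<lambda>i. (cmod (coord x i))\<^sup>2) summable_on UNIV"
  using coord[of x] by simp

lemma ell2_eqI: "(\<And>i. coord x i = coord y i) \<Longrightarrow> x = y"
  by (simp add: coord_inject[symmetric] ext)

lemma square_summable_add:
  fixes x y :: "'i \<Rightarrow> complex"
  assumes "(\<lambda>i. (cmod (x i))\<^sup>2) summable_on UNIV" "(\<lambda>i. (cmod (y i))\<^sup>2) summable_on UNIV"
  shows "(\<lambda>i. (cmod (x i + y i))\<^sup>2) summable_on UNIV"
proof (rule summable_on_comparison_test)
  show "(\<lambda>i. 2 * (cmod (x i))\<^sup>2 + 2 * (cmod (y i))\<^sup>2) summable_on UNIV"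
    by (intro summable_on_add summable_on_cmult_right assms)
  fix i
  have "(cmod (x i + y i))\<^sup>2 \<le> (cmod (x i) + cmod (y i))\<^sup>2"
    by (intro power_mono norm_triangle_ineq norm_ge_zero)
  also have "\<dots> \<le> 2 * (cmod (x i))\<^sup>2 + 2 * (cmod (y i))\<^sup>2"
    using sum_squares_bound[of "cmod (x i)" "cmod (y i)"] by (simp add: power2_sum)
  finally show "(cmod (x i + y i))\<^sup>2 \<le> 2 * (cmod (x i))\<^sup>2 + 2 * (cmod (y i))\<^sup>2" .
qed simp

lemma square_summable_cmult:
  fixes x :: "'i \<Rightarrow> complex"
  assumes "(\<lambda>i. (cmod (x i))\<^sup>2) summable_on UNIV"
  shows "(\<lambda>i. (cmod (c * x i))\<^sup>2) summable_on UNIV"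
  using summable_on_cmult_right[OF assms, of "(cmod c)\<^sup>2"]
  by (simp add: norm_mult power_mult_distrib)

lemma square_summable_single:
  "(\<lambda>i. (cmod (if i = k then c else 0))\<^sup>2) summable_on UNIV"
proof -
  have "(\<lambda>i. (cmod (if i = k then c else 0))\<^sup>2) summable_on {k}"
    by simp
  then show ?thesis
    by (subst summable_on_cong_neutral[of "{k}"]) auto
qed

instantiation ell2 :: (type) real_vector
begin

lift_definition zero_ell2 :: "'a ell2" is "\<lambda>_. 0" by simp
lift_definition plus_ell2 :: "'a ell2 \<Rightarrow> 'a ell2 \<Rightarrow> 'a ell2" is "\<lambda>x y i. x i + y i"
  by (rule square_summable_add)
lift_definition uminus_ell2 :: "'a ell2 \<Rightarrow> 'a ell2" is "\<lambda>x i. - x i" by simp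
lift_definition minus_ell2 :: "'a ell2 \<Rightarrow> 'a ell2 \<Rightarrow> 'a ell2" is "\<lambda>x y i. x i - y i"
  using square_summable_add[of _ "\<lambda>i. - _ i"] by simp
lift_definition scaleR_ell2 :: "real \<Rightarrow> 'a ell2 \<Rightarrow> 'a ell2" is "\<lambda>r x i. of_real r * x i"
  by (rule square_summable_cmult)

instance
  by standard (transfer; simp add: algebra_simps)+

end

lift_definition scaleC :: "complex \<Rightarrow> 'i ell2 \<Rightarrow> 'i ell2" (infixr \<open>*\<^sub>C\<close> 75) is "\<lambda>c x i. c * x i"
  by (rule square_summable_cmult)

text \<open>The inner product is linear in its first argument.\<close>

definition cinner :: "'i ell2 \<Rightarrow> 'i ell2 \<Rightarrow> complex"
  where "cinner x y = (\<Sum>\<^sub>\<infinity>i. coord x i * cnj (coord y i))"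

lift_definition basis_vec :: "'i \<Rightarrow> 'i ell2" is "\<lambda>k i. if i = k then 1 else 0"
  by (rule square_summable_single)

lemma coord_simps [simp]:
  "coord 0 i = 0"
  "coord (x + y) i = coord x i + coord y i"
  "coord (x - y) i = coord x i - coord y i"
  "coord (- x) i = - coord x i"
  "coord (r *\<^sub>R x) i = of_real r * coord x i"
  "coord (c *\<^sub>C x) i = c * coord x i"
  "coord (basis_vec k) i = (if i = k then 1 else 0)"
  by (transfer; simp)+

lemma cinner_summable: "(\<lambda>i. coord x i * cnj (coord y i)) summable_on UNIV"
proof (rule abs_summable_summable, rule summable_on_comparison_test)
  show "(\<lambda>i. (cmod (coord x i))\<^sup>2 + (cmod (coord y i))\<^sup>2) summable_on UNIV"
    by (intro summable_on_add coord_square_summable)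
  fix i
  show "cmod (coord x i * cnj (coord y i)) \<le> (cmod (coord x i))\<^sup>2 + (cmod (coord y i))\<^sup>2"
    using sum_squares_bound[of "cmod (coord x i)" "cmod (coord y i)"]
      mult_nonneg_nonneg[of "cmod (coord x i)" "cmod (coord y i)"]
    by (simp add: norm_mult del: mult_nonneg_nonneg zero_le_mult_iff)
qed simp

lemma cinner_commute: "cinner x y = cnj (cinner y x)"
  unfolding cinner_def infsum_cnj[symmetric] by (simp add: mult.commute)

lemma cinner_add_left: "cinner (x + y) z = cinner x z + cinner y z"
  unfolding cinner_def
  by (simp add: distrib_right infsum_add[OF cinner_summable cinner_summable])

lemma cinner_scaleC_left: "cinner (c *\<^sub>C x) y = c * cinner x y"
  unfolding cinner_def by (simp add: mult.assoc infsum_cmult_right')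

lemma scaleR_scaleC: "r *\<^sub>R x = of_real r *\<^sub>C (x :: 'i ell2)"
  by (rule ell2_eqI) simp

lemma cinner_self: "cinner x x = of_real (\<Sum>\<^sub>\<infinity>i. (cmod (coord x i))\<^sup>2)"
proof -
  have "((\<lambda>i. (cmod (coord x i))\<^sup>2) has_sum (\<Sum>\<^sub>\<infinity>i. (cmod (coord x i))\<^sup>2)) UNIV"
    by (rule has_sum_infsum[OF coord_square_summable])
  then have "((\<lambda>i. complex_of_real ((cmod (coord x i))\<^sup>2)) has_sum
      of_real (\<Sum>\<^sub>\<infinity>i. (cmod (coord x i))\<^sup>2)) UNIV"
    by (rule has_sum_of_real)
  then show ?thesis
    unfolding cinner_def by (intro infsumI) (simp only: complex_norm_square)
qed

lemma cinner_basis_vec_right: "cinner x (basis_vec k) = coord x k"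
proof -
  have "cinner x (basis_vec k) = (\<Sum>\<^sub>\<infinity>i\<in>{k}. coord x i)"
    unfolding cinner_def by (rule infsum_cong_neutral) auto
  then show ?thesis by simp
qed

text \<open>
  The real part of the complex inner product induces the norm and topology, so that the
  library's \<open>bounded_linear\<close> is available.
\<close>

instantiation ell2 :: (type) real_inner
begin

definition inner_ell2 :: "'a ell2 \<Rightarrow> 'a ell2 \<Rightarrow> real"
  where "inner_ell2 x y = Re (cinner x y)"
definition norm_ell2 :: "'a ell2 \<Rightarrow> real"
  where "norm_ell2 x = sqrt (inner x x)"
definition sgn_ell2 :: "'a ell2 \<Rightarrow> 'a ell2"
  where "sgn_ell2 x = x /\<^sub>R norm x"
definition dist_ell2 :: "'a ell2 \<Rightarrow> 'a ell2 \<Rightarrow> real"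
  where "dist_ell2 x y = norm (x - y)"
definition uniformity_ell2 :: "('a ell2 \<times> 'a ell2) filter"
  where "uniformity_ell2 = (INF e\<in>{0 <..}. principal {(x, y). dist x y < e})"
definition open_ell2 :: "'a ell2 set \<Rightarrow> bool"
  where "open_ell2 U = (\<forall>x\<in>U. \<forall>\<^sub>F (x', y) in uniformity. x' = x \<longrightarrow> y \<in> U)"

instance
proof
  fix x y z :: "'a ell2" and r :: real
  show "inner x y = inner y x"
    by (metis inner_ell2_def cinner_commute complex_cnj(1) complex.sel(1) complex.exhaust_sel)
  show "inner (x + y) z = inner x z + inner y z"
    by (simp add: inner_ell2_def cinner_add_left)
  show "inner (r *\<^sub>R x) y = r * inner x y"
    by (simp add: inner_ell2_def scaleR_scaleC cinner_scaleC_left)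
  show "0 \<le> inner x x"
    by (simp add: inner_ell2_def cinner_self infsum_nonneg)
  show "inner x x = 0 \<longleftrightarrow> x = 0"
  proof
    assume "inner x x = 0"
    then have "(\<Sum>\<^sub>\<infinity>i. (cmod (coord x i))\<^sup>2) \<le> 0"
      by (simp add: inner_ell2_def cinner_self)
    then have "(cmod (coord x i))\<^sup>2 = 0" for i
      by (rule nonneg_infsum_le_0D[OF _ coord_square_summable]) auto
    then show "x = 0" by (intro ell2_eqI) simp
  qed (simp add: inner_ell2_def cinner_self)
qed (rule norm_ell2_def sgn_ell2_def dist_ell2_def uniformity_ell2_def open_ell2_def)+

end

section \<open>Bounded operators\<close>

definition bounded_clinear :: "('i ell2 \<Rightarrow> 'j ell2) \<Rightarrow> bool"
  where "bounded_clinear T \<longleftrightarrow> bounded_linear T \<and> (\<forall>c x. T (c *\<^sub>C x) = c *\<^sub>C T x)"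

text \<open>
  By the Riesz theorem every bounded operator has an adjoint; it is unique by
  \<open>cadjoint_eqI\<close>. For other functions the value of \<open>cadjoint\<close> is not used.
\<close>

definition cadjoint :: "('i ell2 \<Rightarrow> 'j ell2) \<Rightarrow> 'j ell2 \<Rightarrow> 'i ell2"
  where "cadjoint T = (THE S. \<forall>x y. cinner (T x) y = cinner x (S y))"

lemma cadjoint_eqI:
  assumes "\<And>x y. cinner (T x) y = cinner x (S y)"
  shows "cadjoint T = S"
  unfolding cadjoint_def
proof (rule the_equality)
  fix S' assume S': "\<forall>x y. cinner (T x) y = cinner x (S' y)"
  have "coord (S' y) i = coord (S y) i" for y i
  proof -
    have "cinner (basis_vec i) (S' y) = cinner (basis_vec i) (S y)"
      using S' assms by metis
    then show ?thesis
      by (metis cinner_basis_vec_right cinner_commute)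
  qed
  then show "S' = S" by (intro ext ell2_eqI)
qed (use assms in blast)

definition commutator :: "('i ell2 \<Rightarrow> 'i ell2) \<Rightarrow> ('i ell2 \<Rightarrow> 'i ell2) \<Rightarrow> 'i ell2 \<Rightarrow> 'i ell2"
  where "commutator S T = (\<lambda>x. S (T x) - T (S x))"

definition positive_op :: "('i ell2 \<Rightarrow> 'i ell2) \<Rightarrow> bool"
  where "positive_op A \<longleftrightarrow> (\<forall>x. cinner (A x) x \<in> \<real>\<^sub>\<ge>\<^sub>0)"

text \<open>\<open>S\<^sup>* S \<ge> S S\<^sup>*\<close> means that \<open>S\<^sup>* S - S S\<^sup>*\<close> is positive.\<close>

definition hyponormal :: "('i ell2 \<Rightarrow> 'i ell2) \<Rightarrow> bool"
  where "hyponormal S \<longleftrightarrow> bounded_clinear S \<and>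
    positive_op (\<lambda>x. cadjoint S (S x) - S (cadjoint S x))"

definition poly_op :: "complex poly \<Rightarrow> ('i ell2 \<Rightarrow> 'i ell2) \<Rightarrow> 'i ell2 \<Rightarrow> 'i ell2"
  where "poly_op p S = (\<lambda>x. \<Sum>n\<le>degree p. coeff p n *\<^sub>C (S ^^ n) x)"

definition quadratically_hyponormal :: "('i ell2 \<Rightarrow> 'i ell2) \<Rightarrow> bool"
  where "quadratically_hyponormal S \<longleftrightarrow> bounded_clinear S \<and>
    (\<forall>p. degree p \<le> 2 \<longrightarrow> hyponormal (poly_op p S))"

text \<open>\<open>op_matrix A B C D\<close> is the operator matrix with rows \<open>(A, B)\<close> and \<open>(C, D)\<close>.\<close>

definition op_matrix :: "('i ell2 \<Rightarrow> 'i ell2) \<Rightarrow> ('i ell2 \<Rightarrow> 'i ell2) \<Rightarrow>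
    ('i ell2 \<Rightarrow> 'i ell2) \<Rightarrow> ('i ell2 \<Rightarrow> 'i ell2) \<Rightarrow> 'i ell2 \<times> 'i ell2 \<Rightarrow> 'i ell2 \<times> 'i ell2"
  where "op_matrix A B C D = (\<lambda>(x, y). (A x + B y, C x + D y))"

definition cinner_sum :: "'i ell2 \<times> 'i ell2 \<Rightarrow> 'i ell2 \<times> 'i ell2 \<Rightarrow> complex"
  where "cinner_sum v w = cinner (fst v) (fst w) + cinner (snd v) (snd w)"

definition positive_op_sum :: "('i ell2 \<times> 'i ell2 \<Rightarrow> 'i ell2 \<times> 'i ell2) \<Rightarrow> bool"
  where "positive_op_sum A \<longleftrightarrow> (\<forall>v. cinner_sum (A v) v \<in> \<real>\<^sub>\<ge>\<^sub>0)"

definition jointly_hyponormal :: "('i ell2 \<Rightarrow> 'i ell2) \<Rightarrow> ('i ell2 \<Rightarrow> 'i ell2) \<Rightarrow> bool"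
  where "jointly_hyponormal T1 T2 \<longleftrightarrow>
    bounded_clinear T1 \<and> bounded_clinear T2 \<and> T1 \<circ> T2 = T2 \<circ> T1 \<and>
    positive_op_sum (op_matrix
      (commutator (cadjoint T1) T1) (commutator (cadjoint T2) T1)
      (commutator (cadjoint T1) T2) (commutator (cadjoint T2) T2))"

section \<open>Two-variable weighted shifts\<close>

abbreviation eps1 :: "nat \<times> nat" where "eps1 \<equiv> (1, 0)"
abbreviation eps2 :: "nat \<times> nat" where "eps2 \<equiv> (0, 1)"

definition weighted_shift2 :: "(nat \<times> nat \<Rightarrow> real) \<Rightarrow> (nat \<times> nat \<Rightarrow> real) \<Rightarrow>
    ((nat \<times> nat) ell2 \<Rightarrow> (nat \<times> nat) ell2) \<Rightarrow> ((nat \<times> nat) ell2 \<Rightarrow> (nat \<times> nat) ell2) \<Rightarrow> bool"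
  where "weighted_shift2 \<alpha> \<beta> T1 T2 \<longleftrightarrow>
    bounded (range \<alpha>) \<and> bounded (range \<beta>) \<and> (\<forall>k. \<alpha> k > 0) \<and> (\<forall>k. \<beta> k > 0) \<and>
    bounded_clinear T1 \<and> bounded_clinear T2 \<and>
    (\<forall>k. T1 (basis_vec k) = of_real (\<alpha> k) *\<^sub>C basis_vec (k + eps1)) \<and>
    (\<forall>k. T2 (basis_vec k) = of_real (\<beta> k) *\<^sub>C basis_vec (k + eps2))"

text \<open>Every pair of bounded positive weight families is realised by operators.\<close>

lemma ex_shift_operator:
  fixes w :: "'i \<Rightarrow> real" and g :: "'i \<Rightarrow> 'i"
  assumes w: "bounded (range w)" and g: "inj g"
  shows "\<exists>T. bounded_clinear T \<and> (\<forall>k. T (basis_vec k) = of_real (w k) *\<^sub>C basis_vec (g k))"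
proof -
  obtain B where B: "\<And>k. \<bar>w k\<bar> \<le> B"
    using w by (auto simp: bounded_iff)
  define f where "f x j = (if j \<in> range g then of_real (w (inv g j)) * coord x (inv g j) else 0)"
    for x :: "'i ell2" and j
  have fg: "f x (g i) = of_real (w i) * coord x i" for x i
    using g by (simp add: f_def)
  have le: "(cmod (f x (g i)))\<^sup>2 \<le> B\<^sup>2 * (cmod (coord x i))\<^sup>2" for x i
  proof -
    have "\<bar>w i\<bar>\<^sup>2 \<le> B\<^sup>2" using B[of i] by (intro power_mono) auto
    then show ?thesis
      by (simp add: fg norm_mult power_mult_distrib mult_right_mono)
  qed
  have sg: "(\<lambda>i. (cmod (f x (g i)))\<^sup>2) summable_on UNIV" for x
    by (rule summable_on_comparison_test[OF summable_on_cmult_right[OF coord_square_summable]])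
      (use le in auto)
  have sf: "(\<lambda>j. (cmod (f x j))\<^sup>2) summable_on UNIV" for x
  proof -
    have "(\<lambda>j. (cmod (f x j))\<^sup>2) summable_on range g"
      using sg g by (simp add: summable_on_reindex o_def)
    then show ?thesis
      by (subst summable_on_cong_neutral[of "range g"]) (auto simp: f_def)
  qed
  have nf: "(\<Sum>\<^sub>\<infinity>j. (cmod (f x j))\<^sup>2) \<le> B\<^sup>2 * (\<Sum>\<^sub>\<infinity>i. (cmod (coord x i))\<^sup>2)" for x
  proof -
    have "(\<Sum>\<^sub>\<infinity>j. (cmod (f x j))\<^sup>2) = (\<Sum>\<^sub>\<infinity>j\<in>range g. (cmod (f x j))\<^sup>2)"
      by (rule infsum_cong_neutral) (auto simp: f_def)
    also have "\<dots> = (\<Sum>\<^sub>\<infinity>i. (cmod (f x (g i)))\<^sup>2)"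
      using g by (simp add: infsum_reindex o_def)
    also have "\<dots> \<le> (\<Sum>\<^sub>\<infinity>i. B\<^sup>2 * (cmod (coord x i))\<^sup>2)"
      by (rule infsum_mono[OF sg summable_on_cmult_right[OF coord_square_summable] le])
    finally show ?thesis by (simp add: infsum_cmult_right')
  qed
  define T where "T x = Abs_ell2 (f x)" for x
  have cT: "coord (T x) j = f x j" for x j
    unfolding T_def using sf[of x] by (simp add: Abs_ell2_inverse)
  have normeq: "norm (x :: 'i ell2) = sqrt (\<Sum>\<^sub>\<infinity>i. (cmod (coord x i))\<^sup>2)" for x
    by (simp add: norm_ell2_def inner_ell2_def cinner_self)
  have "bounded_linear T"
  proof (rule bounded_linear_intro[where K = "\<bar>B\<bar>"])
    show "T (x + y) = T x + T y" for x y
      by (rule ell2_eqI) (simp add: cT f_def algebra_simps)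
    show "T (r *\<^sub>R x) = r *\<^sub>R T x" for r x
      by (rule ell2_eqI) (simp add: cT f_def algebra_simps)
    show "norm (T x) \<le> norm x * \<bar>B\<bar>" for x
      using real_sqrt_le_mono[OF nf[of x]]
      by (simp add: normeq cT real_sqrt_mult mult.commute)
  qed
  moreover have "T (c *\<^sub>C x) = c *\<^sub>C T x" for c x
    by (rule ell2_eqI) (simp add: cT f_def algebra_simps)
  moreover have "T (basis_vec k) = of_real (w k) *\<^sub>C basis_vec (g k)" for k
    by (rule ell2_eqI) (use g in \<open>auto simp: cT f_def\<close>)
  ultimately show ?thesis
    unfolding bounded_clinear_def by blast
qed

lemma ex_weighted_shift2:
  assumes "bounded (range \<alpha>)" "bounded (range \<beta>)" "\<forall>k. \<alpha> k > 0" "\<forall>k. \<beta> k > 0"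
  shows "\<exists>T1 T2. weighted_shift2 \<alpha> \<beta> T1 T2"
proof -
  have "inj (\<lambda>k. k + eps1)" "inj (\<lambda>k. k + eps2)"
    by (auto simp: inj_on_def)
  then show ?thesis
    using ex_shift_operator[OF assms(1)] ex_shift_operator[OF assms(2)] assms
    unfolding weighted_shift2_def by metis
qed

end

theory Submission
  imports Defs
begin

text \<open>
  Flatness first spreads along one line of the grid, by quadratic hyponormality of a single
  operator, and then from line to line, by joint hyponormality.

  Along a line, let \<open>T\<close> shift a sequence of basis vectors with weights \<open>w\<^sub>n\<close>. Quadratic
  hyponormality says \<open>\<parallel>(T + s T\<^sup>2)\<^sup>* x\<parallel> \<le> \<parallel>(T + s T\<^sup>2) x\<parallel>\<close> for every \<open>s\<close> and \<open>x\<close>, which is an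
  inequality between explicit sums of squares (\<open>chain_inequality\<close>). Suppose that two consecutive
  weights, neither of them the first, have the common value \<open>a\<close>. For \<open>s = t / a\<close> and small
  \<open>t\<close>, test the inequality on a vector with entries close to \<open>- t, 1, - t\<close> around the position
  at which the second of these weights acts. All terms of order below \<open>t^4\<close> cancel, and entries
  of order \<open>t^2\<close> further out can be chosen such that the order \<open>t^4\<close> leaves only a square that
  measures how far the next weight is from \<open>a\<close>, on the side where it makes the inequality fail.
  Letting \<open>t\<close> tend to \<open>0\<close> shows that the next weight is \<open>a\<close> as well (\<open>equal_weights_forward\<close>).
  A similar vector reaches the previous weight (\<open>equal_weights_backward\<close>), but there the square
  carries the weight before that one as a factor, so that nothing is obtained about \<open>w\<^sub>0\<close>.
  All weights from \<open>w\<^sub>1\<close> on are therefore equal (\<open>equal_weights_propagate\<close>).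

  Across lines, positivity of the operator matrix is tested on \<open>e(k + \<epsilon>\<^sub>1)\<close> in the first and
  \<open>e(k + \<epsilon>\<^sub>2)\<close> in the second component. If \<open>\<alpha>(k + \<epsilon>\<^sub>1) = \<alpha>(k)\<close>, one diagonal entry of
  the resulting two-by-two matrix vanishes, hence so does its off-diagonal entry
  \<open>\<alpha>(k + \<epsilon>\<^sub>2) \<beta>(k + \<epsilon>\<^sub>1) - \<alpha>(k) \<beta>(k)\<close>. With the commutation rule
  \<open>\<beta>(k + \<epsilon>\<^sub>1) \<alpha>(k) = \<alpha>(k + \<epsilon>\<^sub>2) \<beta>(k)\<close> this yields \<open>\<alpha>(k + \<epsilon>\<^sub>2) = \<alpha>(k)\<close>
  (\<open>weight_transfer_at_equality\<close>), and a constant line forces the same constant on the line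
  after it (\<open>flat_from_level\<close>). The two halves of the theorem are exchanged by swapping the
  operators.
\<close>

section \<open>Adjoints and norms in coordinates\<close>

lemma norm_sq_infsum: "(norm x)\<^sup>2 = (\<Sum>\<^sub>\<infinity>i. (cmod (coord x i))\<^sup>2)"
  by (simp add: power2_norm_eq_inner inner_ell2_def cinner_self)

lemma cinner_self_norm: "cinner x x = of_real ((norm x)\<^sup>2)"
  by (simp add: norm_sq_infsum cinner_self)

lemma cinner_add_right: "cinner x (y + z) = cinner x y + cinner x z"
  by (metis cinner_commute cinner_add_left complex_cnj_add)

lemma cinner_scaleC_right: "cinner x (c *\<^sub>C y) = cnj c * cinner x y"
  by (metis cinner_commute cinner_scaleC_left complex_cnj_mult)

lemma cinner_diff_left: "cinner (x - y) z = cinner x z - cinner y z"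
  using cinner_add_left[of "x - y" y z] by simp

lemma cinner_basis_vec_left: "cinner (basis_vec k) x = cnj (coord x k)"
  by (metis cinner_commute cinner_basis_vec_right)

lemma coord_sum: "coord (\<Sum>i\<in>F. g i) k = (\<Sum>i\<in>F. coord (g i) k)"
  by (induction F rule: infinite_finite_induct) auto

lemma scaleC_sum_right: "c *\<^sub>C (\<Sum>i\<in>F. g i) = (\<Sum>i\<in>F. c *\<^sub>C g i)"
  by (rule ell2_eqI) (simp add: coord_sum sum_distrib_left)

lemma scaleC_scaleC: "c *\<^sub>C (d *\<^sub>C x) = (c * d) *\<^sub>C x"
  by (rule ell2_eqI) (simp add: algebra_simps)

lemma scaleC_left_simps:
  "(c + d) *\<^sub>C x = c *\<^sub>C x + d *\<^sub>C x" "0 *\<^sub>C x = 0" "1 *\<^sub>C x = x" "c *\<^sub>C 0 = 0"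
  by (rule ell2_eqI, simp add: algebra_simps)+

lemma bessel_coord:
  assumes "finite F"
  shows "(\<Sum>i\<in>F. (cmod (coord x i))\<^sup>2) \<le> (norm x)\<^sup>2"
  unfolding norm_sq_infsum
  by (rule finite_sum_le_infsum[OF coord_square_summable assms]) auto

lemma norm_sq_finite_support:
  assumes "finite F" "\<And>i. i \<notin> F \<Longrightarrow> coord x i = 0"
  shows "(norm x)\<^sup>2 = (\<Sum>i\<in>F. (cmod (coord x i))\<^sup>2)"
proof -
  have "(norm x)\<^sup>2 = (\<Sum>\<^sub>\<infinity>i\<in>F. (cmod (coord x i))\<^sup>2)"
    unfolding norm_sq_infsum by (rule infsum_cong_neutral) (use assms(2) in auto)
  then show ?thesis using assms(1) by simp
qed

text \<open>The remainder after a finite set \<open>F\<close> of terms has squared norm equal to the tail of the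
  square sum outside \<open>F\<close>.\<close>

lemma has_sum_basis_expansion:
  "((\<lambda>i. coord x i *\<^sub>C basis_vec i) has_sum x) UNIV"
  unfolding has_sum_def
proof -
  let ?P = "\<lambda>F. \<Sum>i\<in>F. coord x i *\<^sub>C basis_vec i"
  have eq: "(norm (?P F - x))\<^sup>2 = (norm x)\<^sup>2 - (\<Sum>i\<in>F. (cmod (coord x i))\<^sup>2)" if "finite F" for F
  proof -
    have c: "coord (?P F) i = (if i \<in> F then coord x i else 0)" for i
      using that by (simp add: coord_sum if_distrib cong: if_cong)
    have "(norm x)\<^sup>2 = (\<Sum>\<^sub>\<infinity>i\<in>F. (cmod (coord x i))\<^sup>2) + (\<Sum>\<^sub>\<infinity>i\<in>-F. (cmod (coord x i))\<^sup>2)"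
      unfolding norm_sq_infsum
      by (subst infsum_Un_disjoint[symmetric])
        (use that in \<open>auto intro: summable_on_subset_banach[OF coord_square_summable]
          simp: Un_commute\<close>)
    moreover have "(norm (?P F - x))\<^sup>2 = (\<Sum>\<^sub>\<infinity>i\<in>-F. (cmod (coord x i))\<^sup>2)"
      unfolding norm_sq_infsum by (rule infsum_cong_neutral) (auto simp: c)
    ultimately show ?thesis using that by simp
  qed
  have "((\<lambda>F. (norm x)\<^sup>2 - (\<Sum>i\<in>F. (cmod (coord x i))\<^sup>2)) \<longlongrightarrow> (norm x)\<^sup>2 - (norm x)\<^sup>2)
      (finite_subsets_at_top UNIV)"
    using has_sum_infsum[OF coord_square_summable, of x]
    unfolding has_sum_def norm_sq_infsum[symmetric] by (intro tendsto_diff tendsto_const)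
  then have "((\<lambda>F. (norm (?P F - x))\<^sup>2) \<longlongrightarrow> 0) (finite_subsets_at_top UNIV)"
    by (subst tendsto_cong[where g = "\<lambda>F. (norm x)\<^sup>2 - (\<Sum>i\<in>F. (cmod (coord x i))\<^sup>2)"])
      (auto intro!: eventually_finite_subsets_at_top_weakI simp: eq)
  then have "((\<lambda>F. sqrt ((norm (?P F - x))\<^sup>2)) \<longlongrightarrow> sqrt 0) (finite_subsets_at_top UNIV)"
    by (rule tendsto_real_sqrt)
  then show "(?P \<longlongrightarrow> x) (finite_subsets_at_top UNIV)"
    by (simp add: tendsto_norm_zero_iff LIM_zero_iff)
qed

lemma bounded_clinear_scaleC: "bounded_clinear T \<Longrightarrow> T (c *\<^sub>C x) = c *\<^sub>C T x"
  by (simp add: bounded_clinear_def)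

lemma bounded_clinear_linear: "bounded_clinear T \<Longrightarrow> linear T"
  by (simp add: bounded_clinear_def bounded_linear.linear)

lemma cinner_eqI_inner:
  assumes "\<And>c. inner (c *\<^sub>C x) y = inner (c *\<^sub>C x') y'"
  shows "cinner x y = cinner x' y'"
proof (rule complex_eqI)
  show "Re (cinner x y) = Re (cinner x' y')"
    using assms[of 1] by (simp add: inner_ell2_def cinner_scaleC_left)
  show "Im (cinner x y) = Im (cinner x' y')"
    using assms[of "- \<i>"] by (simp add: inner_ell2_def cinner_scaleC_left)
qed

text \<open>
  Existence of the adjoint without the Riesz theorem: the candidate for \<open>T\<^sup>* y\<close> has the
  coordinates \<open>\<langle>y, T e\<^sub>i\<rangle>\<close>. Testing \<open>T\<close> on the finite sections of the candidate bounds its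
  square sums, and the adjoint identity extends from basis vectors by continuity.
\<close>

lemma cinner_cadjoint:
  fixes T :: "'i ell2 \<Rightarrow> 'j ell2"
  assumes T: "bounded_clinear T"
  shows "cinner (T x) y = cinner x (cadjoint T y)"
proof -
  have bl: "bounded_linear T" using T by (simp add: bounded_clinear_def)
  obtain B where B: "\<And>x. norm (T x) \<le> norm x * B" "B \<ge> 0"
    using bounded_linear.nonneg_bounded[OF bl] by blast
  define c where "c y i = cinner y (T (basis_vec i))" for y i
  have cle: "(\<Sum>i\<in>F. (cmod (c y i))\<^sup>2) \<le> (B * norm y)\<^sup>2" if F: "finite F" for F y
  proof -
    define z where "z = (\<Sum>i\<in>F. c y i *\<^sub>C basis_vec i)"
    let ?s = "\<Sum>i\<in>F. (cmod (c y i))\<^sup>2"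
    have cz: "coord z i = (if i \<in> F then c y i else 0)" for i
      using F by (simp add: z_def coord_sum if_distrib cong: if_cong)
    have nz: "(norm z)\<^sup>2 = ?s"
      using norm_sq_finite_support[OF F, of z] by (simp add: cz)
    have "T z = (\<Sum>i\<in>F. c y i *\<^sub>C T (basis_vec i))"
      unfolding z_def
      by (simp add: linear_sum[OF bounded_clinear_linear[OF T]] bounded_clinear_scaleC[OF T])
    then have "inner (T z) y = (\<Sum>i\<in>F. inner (c y i *\<^sub>C T (basis_vec i)) y)"
      by (simp add: inner_sum_left)
    also have "\<dots> = ?s"
    proof (rule sum.cong[OF refl])
      fix i
      have "cinner (T (basis_vec i)) y = cnj (c y i)"
        unfolding c_def by (rule cinner_commute)
      then show "inner (c y i *\<^sub>C T (basis_vec i)) y = (cmod (c y i))\<^sup>2"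
        by (simp add: inner_ell2_def cinner_scaleC_left complex_norm_square[symmetric] del: of_real_power)
    qed
    finally have "(norm z)\<^sup>2 \<le> norm (T z) * norm y"
      using norm_cauchy_schwarz[of "T z" y] nz by simp
    also have "\<dots> \<le> norm z * (B * norm y)"
      using mult_right_mono[OF B(1)[of z], of "norm y"] by (simp add: mult_ac)
    finally have "norm z \<le> B * norm y"
      using B(2) by (cases "norm z = 0") (auto simp: power2_eq_square)
    then show ?thesis
      using nz by (metis norm_ge_zero power_mono)
  qed
  have sc: "(\<lambda>i. (cmod (c y i))\<^sup>2) summable_on UNIV" for y
    by (rule nonneg_bdd_above_summable_on) (auto intro!: bdd_aboveI2[where M = "(B * norm y)\<^sup>2"] cle)
  define S where "S y = Abs_ell2 (c y)" for y
  have cS: "coord (S y) i = c y i" for y i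
    unfolding S_def using sc[of y] by (simp add: Abs_ell2_inverse)
  have inner_eq: "inner (T x) y = inner x (S y)" for x y
  proof -
    have s: "((\<lambda>i. coord x i *\<^sub>C basis_vec i) has_sum x) UNIV"
      by (rule has_sum_basis_expansion)
    have "((\<lambda>i. inner (T (coord x i *\<^sub>C basis_vec i)) y) has_sum inner (T x) y) UNIV"
      using has_sum_bounded_linear[OF bounded_linear_compose[OF bounded_linear_inner_left bl] s] .
    moreover have "((\<lambda>i. inner (coord x i *\<^sub>C basis_vec i) (S y)) has_sum inner x (S y)) UNIV"
      using has_sum_bounded_linear[OF bounded_linear_inner_left s] .
    moreover have "inner (T (coord x i *\<^sub>C basis_vec i)) y = inner (coord x i *\<^sub>C basis_vec i) (S y)" for i
    proof -
      have "cinner (T (basis_vec i)) y = cnj (c y i)"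
        unfolding c_def by (rule cinner_commute)
      then show ?thesis
        by (simp add: inner_ell2_def bounded_clinear_scaleC[OF T] cinner_scaleC_left
            cinner_basis_vec_left cS)
    qed
    ultimately show ?thesis
      by (simp add: has_sum_unique)
  qed
  have "cinner (T x) y = cinner x (S y)" for x y
    by (rule cinner_eqI_inner) (simp add: inner_eq flip: bounded_clinear_scaleC[OF T])
  then show ?thesis
    using cadjoint_eqI[of T S] by simp
qed

lemma coord_cadjoint:
  assumes "bounded_clinear T"
  shows "coord (cadjoint T y) i = cinner y (T (basis_vec i))"
  by (metis cinner_cadjoint[OF assms] cinner_basis_vec_right cinner_commute)

lemma cinner_cadjoint_left:
  assumes "bounded_clinear T"
  shows "cinner (cadjoint T x) y = cinner x (T y)"
  by (metis cinner_cadjoint[OF assms] cinner_commute)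

lemma hyponormal_norm_le:
  assumes "hyponormal S"
  shows "(norm (cadjoint S x))\<^sup>2 \<le> (norm (S x))\<^sup>2"
proof -
  have S: "bounded_clinear S" using assms by (simp add: hyponormal_def)
  have "cinner (cadjoint S (S x) - S (cadjoint S x)) x \<in> \<real>\<^sub>\<ge>\<^sub>0"
    using assms by (simp add: hyponormal_def positive_op_def)
  moreover have "cinner (cadjoint S (S x) - S (cadjoint S x)) x
      = of_real ((norm (S x))\<^sup>2 - (norm (cadjoint S x))\<^sup>2)"
    by (simp add: cinner_diff_left cinner_cadjoint[OF S] cinner_cadjoint_left[OF S] cinner_self_norm)
  ultimately show ?thesis
    by (simp only: nonneg_Reals_of_real_iff)
qed

section \<open>Equal weights along one line\<close>

lemma quadratic_poly_op:
  assumes "s \<noteq> 0"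
  shows "poly_op [:0, 1, s:] T x = T x + s *\<^sub>C T (T x)"
  using assms by (simp add: poly_op_def numeral_2_eq_2 scaleC_left_simps)

text \<open>
  The scalar form of hyponormality of \<open>A = T + s T\<^sup>2\<close> for the vector with entries \<open>x\<^sub>j\<close> along the
  chain \<open>f\<close>. The left summands are the squared coordinates of \<open>A\<^sup>* x\<close> at \<open>f j\<close>, the right ones
  those of \<open>A x\<close> at \<open>f (j + 1)\<close>. Off the chain \<open>T\<close> is arbitrary, so \<open>A\<^sup>* x\<close> may have further
  coordinates; only a lower bound for its norm is available, and it suffices.
\<close>

lemma chain_inequality:
  fixes T :: "'i ell2 \<Rightarrow> 'i ell2" and f :: "nat \<Rightarrow> 'i" and w x :: "nat \<Rightarrow> real"
  assumes T: "quadratically_hyponormal T" and f: "inj f"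
    and shift: "\<And>n. T (basis_vec (f n)) = of_real (w n) *\<^sub>C basis_vec (f (Suc n))"
    and s: "s \<noteq> 0" and x: "\<And>j. j \<ge> N \<Longrightarrow> x j = 0"
  shows "(\<Sum>j<N. (w j * (x (Suc j) + s * w (Suc j) * x (Suc (Suc j))))\<^sup>2)
    \<le> (\<Sum>j<Suc N. (w j * (x j + (if j = 0 then 0 else s * w (j - 1) * x (j - 1))))\<^sup>2)"
proof -
  define p where "p = [:0, 1, complex_of_real s:]"
  define A where "A = poly_op p T"
  have bT: "bounded_clinear T" using T by (simp add: quadratically_hyponormal_def)
  have "degree p \<le> 2" by (simp add: p_def)
  then have hA: "hyponormal A"
    using T by (simp add: quadratically_hyponormal_def A_def)
  then have bA: "bounded_clinear A" by (simp add: hyponormal_def)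
  have A: "A z = T z + of_real s *\<^sub>C T (T z)" for z
    using s by (simp add: A_def p_def quadratic_poly_op)
  note lin = linear_sum[OF bounded_clinear_linear[OF bT]] bounded_clinear_scaleC[OF bT]
  define X where "X = (\<Sum>j<N. of_real (x j) *\<^sub>C basis_vec (f j))"
  have cX: "coord X (f i) = of_real (x i)" for i
    using f x[of i] by (auto simp: X_def coord_sum inj_eq if_distrib cong: if_cong)
  have "coord (cadjoint A X) (f j)
      = of_real (w j * (x (Suc j) + s * w (Suc j) * x (Suc (Suc j))))" for j
    by (simp add: coord_cadjoint[OF bA] A lin shift scaleC_scaleC cinner_add_right
        cinner_scaleC_right cinner_basis_vec_right cX algebra_simps)
  then have "(\<Sum>i\<in>f ` {..<N}. (cmod (coord (cadjoint A X) i))\<^sup>2)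
      = (\<Sum>j<N. (w j * (x (Suc j) + s * w (Suc j) * x (Suc (Suc j))))\<^sup>2)"
    using f by (subst sum.reindex) (auto intro: inj_on_subset simp del: of_real_mult of_real_add)
  then have lower: "(\<Sum>j<N. (w j * (x (Suc j) + s * w (Suc j) * x (Suc (Suc j))))\<^sup>2)
      \<le> (norm (cadjoint A X))\<^sup>2"
    by (metis bessel_coord finite_imageI finite_lessThan)
  define y where "y j = w j * (x j + (if j = 0 then 0 else s * w (j - 1) * x (j - 1)))" for j
  define Y where "Y = (\<Sum>j<Suc N. of_real (y j) *\<^sub>C basis_vec (f (Suc j)))"
  have TX: "T X = (\<Sum>j<N. of_real (x j * w j) *\<^sub>C basis_vec (f (Suc j)))"
    by (simp add: X_def lin shift scaleC_scaleC)
  then have "T X = (\<Sum>j<Suc N. of_real (x j * w j) *\<^sub>C basis_vec (f (Suc j)))"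
    using x[of N] by (simp add: scaleC_left_simps)
  moreover have "of_real s *\<^sub>C T (T X)
      = (\<Sum>j<N. of_real (s * (x j * w j * w (Suc j))) *\<^sub>C basis_vec (f (Suc (Suc j))))"
    by (simp add: TX lin shift scaleC_scaleC scaleC_sum_right)
  then have "of_real s *\<^sub>C T (T X) = (\<Sum>j<Suc N. of_real (if j = 0 then 0
      else s * (x (j - 1) * w (j - 1) * w j)) *\<^sub>C basis_vec (f (Suc j)))"
    by (subst sum.lessThan_Suc_shift) (simp add: scaleC_left_simps)
  ultimately have AX: "A X = Y"
    unfolding A Y_def
    by (simp only: flip: sum.distrib scaleC_left_simps(1) of_real_add)
      (auto intro!: sum.cong simp: y_def algebra_simps simp del: sum.lessThan_Suc)
  have cY: "coord Y (f (Suc i)) = of_real (if i < Suc N then y i else 0)" for i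
    using f by (auto simp: Y_def coord_sum inj_eq if_distrib cong: if_cong simp del: sum.lessThan_Suc)
  have "(norm Y)\<^sup>2 = (\<Sum>i\<in>(f \<circ> Suc) ` {..<Suc N}. (cmod (coord Y i))\<^sup>2)"
    by (rule norm_sq_finite_support) (auto simp: Y_def coord_sum simp del: sum.lessThan_Suc intro!: sum.neutral)
  also have "\<dots> = (\<Sum>j<Suc N. (y j)\<^sup>2)"
  proof -
    have "inj_on (f \<circ> Suc) {..<Suc N}"
      using f by (metis inj_Suc inj_compose inj_on_subset subset_UNIV)
    then show ?thesis
      by (subst sum.reindex) (auto simp: cY simp del: sum.lessThan_Suc)
  qed
  finally show ?thesis
    using hyponormal_norm_le[OF hA, of X] lower by (simp add: AX y_def)
qed

lemma zero_of_le_sq_mult: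
  fixes c K :: real
  assumes "\<And>t. t > 0 \<Longrightarrow> c \<le> t\<^sup>2 * K"
  shows "c \<le> 0"
proof (rule tendsto_lowerbound)
  show "((\<lambda>t. t\<^sup>2 * K) \<longlongrightarrow> 0) (at_right 0)"
    by (auto intro!: tendsto_eq_intros)
  show "eventually (\<lambda>t. c \<le> t\<^sup>2 * K) (at_right 0)"
    using assms by (simp add: eventually_at_right_less eventually_at_filter)
qed simp

text \<open>
  The entries \<open>- t, 1, - t\<close> alone make all orders below \<open>t^4\<close> cancel. The outer entries lower
  \<open>\<parallel>A x\<parallel>\<^sup>2\<close> at order \<open>t^4\<close>: without the one at \<open>0\<close> it would be larger by \<open>a\<^sup>2 t^4\<close> up to
  terms of order \<open>t^6\<close>, and the one at \<open>4\<close> is chosen to annihilate the coordinate of \<open>A x\<close> at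
  \<open>5\<close>. What remains, after division by \<open>t^4\<close>, is \<open>a\<^sup>2 (1 - b)\<^sup>2 \<le> O(t\<^sup>2)\<close> with
  \<open>b = w\<^sub>3\<^sup>2 / a\<^sup>2\<close>.
\<close>

lemma equal_weights_forward:
  fixes T :: "'i ell2 \<Rightarrow> 'i ell2" and f :: "nat \<Rightarrow> 'i" and w :: "nat \<Rightarrow> real"
  assumes T: "quadratically_hyponormal T" and f: "inj f"
    and shift: "\<And>n. T (basis_vec (f n)) = of_real (w n) *\<^sub>C basis_vec (f (Suc n))"
    and pos: "\<And>n. w n > 0" and eq: "w 2 = w 1"
  shows "w 3 = w 2"
proof -
  define a where "a = w 1"
  have w: "w 1 = a" "w 2 = a" "w (Suc 0) = a" "a > 0" using eq pos[of 1] by (auto simp: a_def)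
  have w0: "w 0 > 0" by (rule pos)
  define b where "b = (w 3)\<^sup>2 / a\<^sup>2"
  define K where "K = (w 3 * w 4 * w 5 / a\<^sup>2)\<^sup>2 + a\<^sup>2"
  have "a\<^sup>2 * (1 - b)\<^sup>2 \<le> t\<^sup>2 * K" if t: "t > 0" for t
  proof -
    define x where "x j = (if j = 0 then t\<^sup>2 * a / w 0 else if j = 1 then - t else if j = 2 then 1
      else if j = 3 then - t else if j = 4 then t\<^sup>2 * w 3 / a else 0)" for j :: nat
    define L where "L j = w j * (x (Suc j) + t / a * w (Suc j) * x (Suc (Suc j)))" for j
    define R where "R j = w j * (x j + (if j = 0 then 0 else t / a * w (j - 1) * x (j - 1)))" for j
    have "x j = 0" if "j \<ge> 5" for j using that by (simp add: x_def)
    from chain_inequality[OF T f shift, of "t / a" 5 x, OF _ this]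
    have "(\<Sum>j<5. (L j)\<^sup>2) \<le> (\<Sum>j<6. (R j)\<^sup>2)"
      using t w by (simp add: L_def R_def)
    then have le: "(L 0)\<^sup>2 + (L 1)\<^sup>2 + (L 2)\<^sup>2 + (L 3)\<^sup>2 + (L 4)\<^sup>2
        \<le> (R 0)\<^sup>2 + (R 1)\<^sup>2 + (R 2)\<^sup>2 + (R 3)\<^sup>2 + (R 4)\<^sup>2 + (R 5)\<^sup>2"
      by (simp add: eval_nat_numeral)
    have L: "L 0 = 0" "L 1 = a * (1 - t\<^sup>2)" "L 2 = a * (t ^ 3 * b - t)" "L 3 = a * (t\<^sup>2 * b)" "L 4 = 0"
      using w by (simp_all add: L_def x_def b_def field_simps power2_eq_square power3_eq_cube
          numeral_2_eq_2[symmetric])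
    have R: "R 0 = t\<^sup>2 * a" "R 1 = a * (t ^ 3 - t)" "R 2 = a * (1 - t\<^sup>2)" "R 3 = 0" "R 4 = 0"
      "R 5 = t ^ 3 * (w 3 * w 4 * w 5 / a\<^sup>2)"
      using w w0 by (simp_all add: R_def x_def field_simps power2_eq_square power3_eq_cube)
    have "t ^ 4 * (a\<^sup>2 * (1 - b)\<^sup>2) + t ^ 6 * (a * b)\<^sup>2 \<le> t ^ 4 * (t\<^sup>2 * K)"
      using le unfolding L R K_def power_mult_distrib
      by (simp add: algebra_simps power2_eq_square power3_eq_cube power4_eq_xxxx eval_nat_numeral)
    moreover have "0 \<le> t ^ 6 * (a * b)\<^sup>2" by simp
    ultimately have "t ^ 4 * (a\<^sup>2 * (1 - b)\<^sup>2) \<le> t ^ 4 * (t\<^sup>2 * K)" by linarith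
    then show ?thesis
      by (rule mult_left_le_imp_le) (use t in simp)
  qed
  then have "a\<^sup>2 * (1 - b)\<^sup>2 \<le> 0" by (rule zero_of_le_sq_mult)
  then have "b = 1"
    using w by (simp add: mult_le_0_iff)
  then have "(w 3)\<^sup>2 = a\<^sup>2"
    using w by (simp add: b_def)
  then show ?thesis
    using pos[of 3] w by (simp add: power2_eq_iff)
qed

text \<open>
  Once the weights are constant from position \<open>2\<close> on, the test vector needs no entries beyond
  \<open>3\<close>. Its entry at \<open>1\<close> brings \<open>\<parallel>A x\<parallel>\<^sup>2\<close> down to \<open>a\<^sup>2 (1 + t^6)\<close>, whereas \<open>A\<^sup>* x\<close> has the
  coordinate \<open>a\<close> at \<open>2\<close> and, at \<open>0\<close>, the coordinate \<open>t\<^sup>2 w\<^sub>0 (a / w\<^sub>1 - w\<^sub>1 / a)\<close>. Letting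
  \<open>t\<close> tend to \<open>0\<close> forces \<open>a / w\<^sub>1 = w\<^sub>1 / a\<close>.
\<close>

lemma equal_weights_backward:
  fixes T :: "'i ell2 \<Rightarrow> 'i ell2" and f :: "nat \<Rightarrow> 'i" and w :: "nat \<Rightarrow> real"
  assumes T: "quadratically_hyponormal T" and f: "inj f"
    and shift: "\<And>n. T (basis_vec (f n)) = of_real (w n) *\<^sub>C basis_vec (f (Suc n))"
    and pos: "\<And>n. w n > 0" and eq: "w 3 = w 2" "w 4 = w 2"
  shows "w 1 = w 2"
proof -
  define a where "a = w 2"
  have w: "w 2 = a" "w 3 = a" "w 4 = a" "a > 0" using eq pos[of 2] by (auto simp: a_def)
  have w1: "w 1 > 0" "w (Suc 0) > 0" by (rule pos)+
  define c where "c = w 0 * (a / w 1 - w 1 / a)"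
  have "c\<^sup>2 \<le> t\<^sup>2 * a\<^sup>2" if t: "t > 0" for t
  proof -
    define x where "x j = (if j = 1 then t\<^sup>2 * a / w 1 else if j = 2 then - t else if j = 3 then 1
      else 0)" for j :: nat
    define L where "L j = w j * (x (Suc j) + t / a * w (Suc j) * x (Suc (Suc j)))" for j
    define R where "R j = w j * (x j + (if j = 0 then 0 else t / a * w (j - 1) * x (j - 1)))" for j
    have "x j = 0" if "j \<ge> 4" for j using that by (simp add: x_def)
    from chain_inequality[OF T f shift, of "t / a" 4 x, OF _ this]
    have "(\<Sum>j<4. (L j)\<^sup>2) \<le> (\<Sum>j<5. (R j)\<^sup>2)"
      using t w by (simp add: L_def R_def)
    then have le: "(L 0)\<^sup>2 + (L 1)\<^sup>2 + (L 2)\<^sup>2 + (L 3)\<^sup>2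
        \<le> (R 0)\<^sup>2 + (R 1)\<^sup>2 + (R 2)\<^sup>2 + (R 3)\<^sup>2 + (R 4)\<^sup>2"
      by (simp add: eval_nat_numeral)
    have L: "L 0 = t\<^sup>2 * c" "L 1 = 0" "L 2 = a" "L 3 = 0"
      using w w1 by (simp_all add: L_def x_def c_def field_simps power2_eq_square
          numeral_2_eq_2[symmetric])
    have R: "R 0 = 0" "R 1 = t\<^sup>2 * a" "R 2 = a * (t ^ 3 - t)" "R 3 = a * (1 - t\<^sup>2)" "R 4 = t * a"
      using w w1 by (simp_all add: R_def x_def field_simps power2_eq_square power3_eq_cube)
    have "t ^ 4 * c\<^sup>2 \<le> t ^ 4 * (t\<^sup>2 * a\<^sup>2)"
      using le unfolding L R power_mult_distrib
      by (simp add: algebra_simps power2_eq_square power3_eq_cube power4_eq_xxxx)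
    then show ?thesis
      by (rule mult_left_le_imp_le) (use t in simp)
  qed
  then have "c\<^sup>2 \<le> 0" by (rule zero_of_le_sq_mult)
  then have "a / w 1 = w 1 / a"
    using pos[of 0] by (simp add: c_def)
  then have "(w 1)\<^sup>2 = a\<^sup>2"
    using w w1 by (simp add: field_simps power2_eq_square)
  then show ?thesis
    using pos[of 1] w by (simp add: power2_eq_iff)
qed

lemma equal_weights_propagate:
  fixes T :: "'i ell2 \<Rightarrow> 'i ell2" and f :: "nat \<Rightarrow> 'i" and w :: "nat \<Rightarrow> real"
  assumes T: "quadratically_hyponormal T" and f: "inj f"
    and shift: "\<And>n. T (basis_vec (f n)) = of_real (w n) *\<^sub>C basis_vec (f (Suc n))"
    and pos: "\<And>n. w n > 0"
    and k: "k \<ge> 1" and eq: "w (Suc k) = w k" and i: "i \<ge> 1"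
  shows "w i = w 1"
proof -
  \<comment> \<open>A tail of the chain is again a chain, so the comparison of its first few
    weights applies at every position.\<close>
  have shift': "T (basis_vec (f (m + n))) = of_real (w (m + n)) *\<^sub>C basis_vec (f (m + Suc n))" for m n
    using shift[of "m + n"] by simp
  have f': "inj (\<lambda>n. f (m + n))" for m
    using f by (auto intro!: injI simp: inj_eq)
  have forward: "w (Suc (Suc n)) = w (Suc n)" if "w (Suc n) = w n" "n \<ge> 1" for n
  proof -
    obtain m where m: "n = Suc m" using \<open>n \<ge> 1\<close> by (cases n) auto
    have "m + 1 = n" "m + 2 = Suc n" "m + 3 = Suc (Suc n)" by (simp_all add: m)
    then show ?thesis
      using equal_weights_forward[OF T f'[of m] shift'[of m] pos] that(1) by metis
  qed
  have backward: "w (Suc n) = w n" if "w (Suc (Suc n)) = w (Suc n)" "n \<ge> 1" for n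
  proof -
    obtain m where m: "n = Suc m" using \<open>n \<ge> 1\<close> by (cases n) auto
    have "m + 1 = n" "m + 2 = Suc n" "m + 3 = Suc (Suc n)" "m + 4 = Suc (Suc (Suc n))"
      by (simp_all add: m)
    moreover have "w (Suc (Suc (Suc n))) = w (Suc n)"
      using forward[OF that(1)] that(1) by simp
    ultimately show ?thesis
      using equal_weights_backward[OF T f'[of m] shift'[of m] pos] that(1) by metis
  qed
  have up: "w (Suc n) = w n" if "n \<ge> k" for n
    using that
  proof (induction n rule: dec_induct)
    case (step n)
    then show ?case using forward k by (meson le_trans)
  qed (rule eq)
  have down: "w (Suc n) = w n" if "n \<le> k" "n \<ge> 1" for n
    using that
  proof (induction n rule: inc_induct)
    case (step n)
    then show ?case using backward by (meson le_SucI)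
  qed (rule eq)
  have "w (Suc n) = w n" if "n \<ge> 1" for n
    using up[of n] down[of n] that by linarith
  with i show ?thesis
    by (induction i rule: dec_induct) auto
qed

section \<open>Joint hyponormality\<close>

text \<open>The quadratic form of the commutator matrix, with all adjoints moved across the inner
  product so that it can be evaluated on shifts.\<close>

lemma jointly_hyponormal_inequality:
  assumes "jointly_hyponormal T1 T2"
  shows "0 \<le> (norm (T1 x))\<^sup>2 - (norm (cadjoint T1 x))\<^sup>2
    + 2 * Re (cinner (T1 y) (T2 x) - cinner (cadjoint T2 y) (cadjoint T1 x))
    + (norm (T2 y))\<^sup>2 - (norm (cadjoint T2 y))\<^sup>2"
proof -
  have T: "bounded_clinear T1" "bounded_clinear T2"
    using assms by (simp_all add: jointly_hyponormal_def)
  note adj = cinner_cadjoint[OF T(1)] cinner_cadjoint[OF T(2)]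
    cinner_cadjoint_left[OF T(1)] cinner_cadjoint_left[OF T(2)]
  let ?M = "op_matrix (commutator (cadjoint T1) T1) (commutator (cadjoint T2) T1)
      (commutator (cadjoint T1) T2) (commutator (cadjoint T2) T2)"
  have "cinner_sum (?M (x, y)) (x, y) \<in> \<real>\<^sub>\<ge>\<^sub>0"
    using assms by (simp add: jointly_hyponormal_def positive_op_sum_def)
  then have "0 \<le> Re (cinner_sum (?M (x, y)) (x, y))"
    by (simp add: complex_nonneg_Reals_iff)
  moreover have "cinner (T2 x) (T1 y) = cnj (cinner (T1 y) (T2 x))"
    "cinner (cadjoint T1 x) (cadjoint T2 y) = cnj (cinner (cadjoint T2 y) (cadjoint T1 x))"
    by (rule cinner_commute)+
  ultimately show ?thesis
    by (simp add: cinner_sum_def op_matrix_def commutator_def cinner_add_left cinner_diff_left adj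
        cinner_self_norm)
qed

text \<open>
  On \<open>c e(g\<^sub>1 k)\<close> and \<open>e(g\<^sub>2 k)\<close> the form is a quadratic polynomial in \<open>c\<close> whose leading
  coefficient \<open>u(g\<^sub>1 k)\<^sup>2 - u(k)\<^sup>2\<close> is zero. Being nonnegative for all real \<open>c\<close>, it has no linear
  term, and comparison with the commutation rule for the weights gives the claim.
\<close>

lemma weight_transfer_at_equality:
  fixes T1 T2 :: "'i ell2 \<Rightarrow> 'i ell2"
  assumes hyp: "jointly_hyponormal T1 T2"
    and g1: "inj g1" and g2: "inj g2" and g12: "\<And>k. g1 (g2 k) = g2 (g1 k)"
    and T1: "\<And>k. T1 (basis_vec k) = of_real (u k) *\<^sub>C basis_vec (g1 k)"
    and T2: "\<And>k. T2 (basis_vec k) = of_real (v k) *\<^sub>C basis_vec (g2 k)"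
    and pos: "\<And>k. u k > 0" "\<And>k. v k > 0"
    and eq: "u (g1 k) = u k"
  shows "u (g2 k) = u k"
proof -
  have bT: "bounded_clinear T1" "bounded_clinear T2" and comm: "T1 \<circ> T2 = T2 \<circ> T1"
    using hyp by (simp_all add: jointly_hyponormal_def)
  have adj2: "cadjoint T2 (basis_vec (g2 j)) = of_real (v j) *\<^sub>C basis_vec j" for j
    using g2 by (intro ell2_eqI) (auto simp: coord_cadjoint[OF bT(2)] T2 cinner_scaleC_right
        cinner_basis_vec_right inj_eq)
  have "coord (T1 (T2 (basis_vec k))) (g1 (g2 k)) = coord (T2 (T1 (basis_vec k))) (g1 (g2 k))"
    using comm by (metis comp_apply)
  then have comm_weights: "v (g1 k) * u k = u (g2 k) * v k"
    by (simp add: T1 T2 bounded_clinear_scaleC[OF bT(1)] bounded_clinear_scaleC[OF bT(2)] g12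
        mult_ac flip: of_real_mult)
  define r where "r = u (g2 k) * v (g1 k) - u k * v k"
  define q where "q = (v (g2 k))\<^sup>2 - (v k)\<^sup>2"
  have norms: "norm (of_real c *\<^sub>C basis_vec i :: 'i ell2) = \<bar>c\<bar>" for c :: real and i
    using norm_sq_finite_support[of "{i}" "of_real c *\<^sub>C basis_vec i"]
    by simp (metis abs_norm_cancel real_sqrt_abs)
  have quad: "0 \<le> 2 * c * r + q" for c
  proof -
    have "cadjoint T1 (of_real c *\<^sub>C basis_vec (g1 k)) = of_real (c * u k) *\<^sub>C basis_vec k"
      using g1 by (intro ell2_eqI) (auto simp: coord_cadjoint[OF bT(1)] T1 cinner_scaleC_right
        cinner_scaleC_left cinner_basis_vec_right inj_eq)
    then show ?thesis
      using jointly_hyponormal_inequality[OF hyp, of "of_real c *\<^sub>C basis_vec (g1 k)" "basis_vec (g2 k)"]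
      by (simp add: adj2 T1 T2 bounded_clinear_scaleC[OF bT(1)] bounded_clinear_scaleC[OF bT(2)]
          scaleC_scaleC norms eq g12 cinner_scaleC_left cinner_scaleC_right cinner_basis_vec_right
          r_def q_def algebra_simps flip: of_real_mult)
  qed
  have "r = 0"
  proof (rule ccontr)
    assume "r \<noteq> 0"
    \<comment> \<open>The value of \<open>c\<close> at which the linear polynomial equals \<open>-1\<close>.\<close>
    then have "2 * (- (q + 1) / (2 * r)) * r + q = - 1" by (simp add: field_simps)
    then show False using quad[of "- (q + 1) / (2 * r)"] by simp
  qed
  then have "u (g2 k) * v (g1 k) = u k * v k" by (simp add: r_def)
  then have "u (g2 k) * (v (g1 k) * u k) = (u k)\<^sup>2 * v k"
    by (simp add: power2_eq_square)
  then have "(u (g2 k))\<^sup>2 = (u k)\<^sup>2"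
    unfolding comm_weights using pos(2)[of k] by (simp add: power2_eq_square)
  then show ?thesis
    using pos(1)[of k] pos(1)[of "g2 k"] by (simp add: power2_eq_iff)
qed

text \<open>
  Rows and columns of the grid are treated alike: \<open>F m n\<close> is the point reached by \<open>m\<close> steps in
  the direction of \<open>T1\<close> and \<open>n\<close> steps in that of \<open>T2\<close>.
\<close>

lemma flat_from_level:
  fixes T1 T2 :: "'i ell2 \<Rightarrow> 'i ell2" and F :: "nat \<Rightarrow> nat \<Rightarrow> 'i"
  assumes hyp: "jointly_hyponormal T1 T2" and quad: "quadratically_hyponormal T1"
    and g1: "inj g1" and g2: "inj g2" and g12: "\<And>k. g1 (g2 k) = g2 (g1 k)"
    and T1: "\<And>k. T1 (basis_vec k) = of_real (u k) *\<^sub>C basis_vec (g1 k)"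
    and T2: "\<And>k. T2 (basis_vec k) = of_real (v k) *\<^sub>C basis_vec (g2 k)"
    and pos: "\<And>k. u k > 0" "\<And>k. v k > 0"
    and F: "\<And>m n. g1 (F m n) = F (Suc m) n" "\<And>m n. g2 (F m n) = F m (Suc n)"
      "\<And>n. inj (\<lambda>m. F m n)"
    and eq: "u (F (Suc k) l) = u (F k l)" "k \<ge> 1" and ij: "i \<ge> 1" "l \<le> j"
  shows "u (F i j) = u (F 1 l)"
proof -
  have row: "u (F m l) = u (F 1 l)" if "m \<ge> 1" for m
    by (rule equal_weights_propagate[OF quad F(3)[of l], where k = k])
      (use that eq pos in \<open>auto simp: T1 F(1)\<close>)
  show ?thesis
    using ij(2,1)
  proof (induction j arbitrary: i rule: dec_induct)
    case base
    then show ?case by (rule row)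
  next
    case (step n)
    have "u (g1 (F i n)) = u (F i n)"
      using step.IH[of i] step.IH[of "Suc i"] step.prems by (simp add: F(1))
    then have "u (F i (Suc n)) = u (F i n)"
      using weight_transfer_at_equality[OF hyp g1 g2 g12 T1 T2 pos, of "F i n"] by (simp add: F(2))
    then show ?case using step by simp
  qed
qed

lemma jointly_hyponormal_swap:
  assumes "jointly_hyponormal T1 T2"
  shows "jointly_hyponormal T2 T1"
proof -
  have "cinner_sum (op_matrix A B C D (x, y)) (x, y) = cinner_sum (op_matrix D C B A (y, x)) (y, x)"
    for A B C D :: "'a ell2 \<Rightarrow> 'a ell2" and x y
    by (simp add: cinner_sum_def op_matrix_def add.commute)
  then show ?thesis
    using assms by (auto simp: jointly_hyponormal_def positive_op_sum_def)
qed

theorem theorem3p3: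
  fixes \<alpha> \<beta> :: "nat \<times> nat \<Rightarrow> real"
    and T1 T2 :: "(nat \<times> nat) ell2 \<Rightarrow> (nat \<times> nat) ell2"
  assumes "weighted_shift2 \<alpha> \<beta> T1 T2"
    and "T1 \<circ> T2 = T2 \<circ> T1"
    and "jointly_hyponormal T1 T2"
  shows "(quadratically_hyponormal T1 \<longrightarrow>
           (\<forall>k1 k2. k1 \<ge> 1 \<and> k2 \<ge> 1 \<and> \<alpha> ((k1, k2) + eps1) = \<alpha> (k1, k2) \<longrightarrow>
             (\<forall>i l. i \<ge> 1 \<and> l \<ge> k2 \<longrightarrow> \<alpha> (i, l) = \<alpha> (1, k2)))) \<and>
         (quadratically_hyponormal T2 \<longrightarrow>
           (\<forall>k1 k2. k1 \<ge> 1 \<and> k2 \<ge> 1 \<and> \<beta> ((k1, k2) + eps2) = \<beta> (k1, k2) \<longrightarrow>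
             (\<forall>l j. l \<ge> k1 \<and> j \<ge> 1 \<longrightarrow> \<beta> (l, j) = \<beta> (k1, 1))))"
proof -
  have pos: "\<And>k. \<alpha> k > 0" "\<And>k. \<beta> k > 0"
    and T: "\<And>k. T1 (basis_vec k) = of_real (\<alpha> k) *\<^sub>C basis_vec (k + eps1)"
      "\<And>k. T2 (basis_vec k) = of_real (\<beta> k) *\<^sub>C basis_vec (k + eps2)"
    using assms(1) by (auto simp only: weighted_shift2_def)
  have g: "inj (\<lambda>k :: nat \<times> nat. k + eps1)" "inj (\<lambda>k :: nat \<times> nat. k + eps2)"
    by (auto intro!: injI)
  have "\<alpha> (i, l) = \<alpha> (1, k2)"
    if "quadratically_hyponormal T1" "k1 \<ge> 1" "\<alpha> ((k1, k2) + eps1) = \<alpha> (k1, k2)"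
      "i \<ge> 1" "l \<ge> k2" for k1 k2 i l :: nat
    by (rule flat_from_level[OF assms(3) that(1) g _ T pos, of "\<lambda>m n. (m, n)" k1])
      (use that in \<open>auto intro: injI\<close>)
  moreover have "\<beta> (l, j) = \<beta> (k1, 1)"
    if "quadratically_hyponormal T2" "k2 \<ge> 1" "\<beta> ((k1, k2) + eps2) = \<beta> (k1, k2)"
      "l \<ge> k1" "j \<ge> 1" for k1 k2 l j :: nat
    by (rule flat_from_level[OF jointly_hyponormal_swap[OF assms(3)] that(1) g(2,1) _ T(2,1) pos(2,1),
          of "\<lambda>m n. (n, m)" k2])
      (use that in \<open>auto intro: injI\<close>)
  ultimately show ?thesis by blast
qed

end
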